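(* Let $\rho,\sigma_1,\sigma_2$ be the probability distributions on $\{h,t\}$ given by $\rho(h)=\frac12$, $\sigma_1(h)=\frac14$, $\sigma_2(h)=\frac34$. For every $k\in\mathbb N$ (where $D(\rho^{\otimes k}\|\sigma_j^{\otimes k})=k\log\frac2{\sqrt3}$ for $j=1,2$), $$\mathrm{sc}_r(\rho^{\otimes k}\|\{\sigma_1^{\otimes k},\sigma_2^{\otimes k}\})-\max_{j\in\{1,2\}}\mathrm{sc}_r(\rho^{\otimes k}\|\sigma_j^{\otimes k})\ \begin{cases}>0,&\text{if } r>k\log\frac2{\sqrt3},\\ \ge k\log\sqrt3,&\text{if } r\ge k\log4.\end{cases}$$
   Context: $\omega^{\otimes k}$ is the $k$-fold product distribution; $\log$ is natural, $-\log0=+\infty$; $D(\rho\|\sigma)=\sum_x\rho(x)\log\frac{\rho(x)}{\sigma(x)}$ is the relative entropy. Strong converse exponent: for a probability distribution $\rho$ and a finite set $S$ of probability distributions on a finite set $\mathcal X$, a test on $n$ samples is a function $T_n:\mathcal X^n\to[0,1]$, and with $\omega^{\otimes n}(T_n)=\sum_{\underline x\in\mathcal X^n}\omega^{\otimes n}(\underline x)T_n(\underline x)$, $$\mathrm{sc}_r(\rho\|S)=\inf\Big\{\limsup_{n\to\infty}-\tfrac1n\log\rho^{\otimes n}(T_n):\ \liminf_{n\to\infty}-\tfrac1n\log\max_{\sigma\in S}\sigma^{\otimes n}(T_n)\ge r\Big\},$$ the infimum being over all test sequences $(T_n)_n$ satisfying the condition; $\mathrm{sc}_r(\rho\|\sigma)=\mathrm{sc}_r(\rho\|\{\sigma\})$.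 In the claim this is applied with $\mathcal X=\{h,t\}^k$. *)

theory Defs
  imports "HOL-Probability.Probability"
begin

definition seqs :: "'a set \<Rightarrow> nat \<Rightarrow> 'a list set"
  where "seqs X n = {xs. set xs \<subseteq> X \<and> length xs = n}"

text \<open>
  A probability distribution on a finite set \<open>X\<close> is a \<open>pmf\<close> with \<open>set_pmf\<close> contained in \<open>X\<close>.
  The product distribution \<open>\<omega>\<^sup>\<otimes>\<^sup>n\<close> is \<^const>\<open>replicate_pmf\<close>, living on the lists of length \<open>n\<close>.
\<close>

lemma pmf_replicate_pmf:
  "pmf (replicate_pmf n p) xs = (if length xs = n then \<Prod>x\<leftarrow>xs. pmf p x else 0)"
proof (induction n arbitrary: xs)
  case 0
  then show ?case by (auto simp: pmf_return indicator_def)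
next
  case (Suc n)
  have pair: "replicate_pmf (Suc n) p = map_pmf (\<lambda>(x, ys). x # ys) (pair_pmf p (replicate_pmf n p))"
    by (simp add: pair_pmf_def map_pmf_def bind_assoc_pmf bind_return_pmf)
  show ?case
  proof (cases xs)
    case Nil
    then show ?thesis by (simp add: pmf_eq_0_set_pmf set_replicate_pmf del: replicate_pmf.simps)
  next
    case (Cons y ys)
    have inj: "inj (\<lambda>(x :: 'a, ys). x # ys)"
      by (auto intro: injI)
    have "pmf (replicate_pmf (Suc n) p) xs = pmf (pair_pmf p (replicate_pmf n p)) (y, ys)"
      using pmf_map_inj'[OF inj, of "pair_pmf p (replicate_pmf n p)" "(y, ys)"] pair Cons by simp
    also have "\<dots> = pmf p y * pmf (replicate_pmf n p) ys"
      by (rule pmf_pair)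
    finally show ?thesis
      using Cons Suc.IH[of ys] by simp
  qed
qed

definition neg_log :: "real \<Rightarrow> ereal"
  where "neg_log x = (if x = 0 then \<infinity> else ereal (- ln x))"

text \<open>Usual conventions: \<open>0 log (0/s) = 0\<close>, and \<open>p log (p/0) = \<infinity>\<close> for \<open>p > 0\<close>.\<close>

definition rel_entropy :: "'a set \<Rightarrow> 'a pmf \<Rightarrow> 'a pmf \<Rightarrow> ereal"
  where "rel_entropy X \<rho> \<sigma> =
    (\<Sum>x\<in>X. if pmf \<rho> x = 0 then 0
          else if pmf \<sigma> x = 0 then \<infinity>
          else ereal (pmf \<rho> x * ln (pmf \<rho> x / pmf \<sigma> x)))"

definition test_seq :: "'a set \<Rightarrow> (nat \<Rightarrow> 'a list \<Rightarrow> real) \<Rightarrow> bool"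
  where "test_seq X T \<longleftrightarrow> (\<forall>n. \<forall>xs\<in>seqs X n. 0 \<le> T n xs \<and> T n xs \<le> 1)"

definition accept :: "'a set \<Rightarrow> nat \<Rightarrow> 'a pmf \<Rightarrow> ('a list \<Rightarrow> real) \<Rightarrow> real"
  where "accept X n \<omega> t = (\<Sum>xs\<in>seqs X n. pmf (replicate_pmf n \<omega>) xs * t xs)"

text \<open>Only sensible for finite \<open>X\<close> and for finite, nonempty \<open>S\<close>.\<close>

definition sc :: "'a set \<Rightarrow> real \<Rightarrow> 'a pmf \<Rightarrow> 'a pmf set \<Rightarrow> ereal"
  where "sc X r \<rho> S =
    Inf {limsup (\<lambda>n. neg_log (accept X n \<rho> (T n)) / ereal (real n)) | T.
           test_seq X T \<and>
           liminf (\<lambda>n. neg_log (MAX \<sigma>\<in>S. accept X n \<sigma> (T n)) / ereal (real n)) \<ge> ereal r}"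

lemma accept_const:
  assumes "finite X" "set_pmf \<omega> \<subseteq> X"
  shows "accept X n \<omega> (\<lambda>_. c) = c"
proof -
  have fin: "finite (seqs X n)"
    unfolding seqs_def by (rule finite_lists_length_eq[OF assms(1)])
  have sub: "set_pmf (replicate_pmf n \<omega>) \<subseteq> seqs X n"
    using assms(2) by (auto simp: set_replicate_pmf seqs_def lists_eq_set)
  have "(\<Sum>xs\<in>seqs X n. pmf (replicate_pmf n \<omega>) xs) = 1"
    by (rule sum_pmf_eq_1[OF fin sub])
  then show ?thesis
    unfolding accept_def by (simp flip: sum_distrib_right)
qed

text \<open>
  The two lemmas below show that the exponents are finite for \<open>r \<ge> 0\<close>, so that differences of them never
  hit the convention \<open>\<infinity> - \<infinity> = \<infinity>\<close> of \<^typ>\<open>ereal\<close>.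
\<close>

lemma sc_le:
  assumes "finite X" "set_pmf \<rho> \<subseteq> X" "finite S" "S \<noteq> {}" "\<And>\<sigma>. \<sigma> \<in> S \<Longrightarrow> set_pmf \<sigma> \<subseteq> X" "0 \<le> r"
  shows "sc X r \<rho> S \<le> ereal r"
proof -
  let ?T = "\<lambda>n (_ :: 'a list). exp (- (real n * r))"
  have ev: "\<forall>\<^sub>F n in sequentially. neg_log (exp (- (real n * r))) / ereal (real n) = ereal r"
    using eventually_gt_at_top[of 0] by eventually_elim (simp add: neg_log_def)
  have lim: "(\<lambda>n. neg_log (exp (- (real n * r))) / ereal (real n)) \<longlonglongrightarrow> ereal r"
    by (rule tendsto_eventually[OF ev])
  have max_eq: "(MAX \<sigma>\<in>S. accept X n \<sigma> (?T n)) = exp (- (real n * r))" for n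
  proof -
    have eq: "accept X n \<sigma> (?T n) = exp (- (real n * r))" if "\<sigma> \<in> S" for \<sigma>
      using accept_const[OF assms(1) assms(5)[OF that]] .
    have "(\<lambda>\<sigma>. accept X n \<sigma> (?T n)) ` S = (\<lambda>_. exp (- (real n * r))) ` S"
      using eq by (rule image_cong[OF refl])
    also have "\<dots> = {exp (- (real n * r))}"
      using assms(4) by auto
    finally show ?thesis by simp
  qed
  have rho_eq: "accept X n \<rho> (?T n) = exp (- (real n * r))" for n
    by (rule accept_const[OF assms(1,2)])
  have "test_seq X ?T"
    using assms(6) by (auto simp: test_seq_def)
  then show ?thesis
    unfolding sc_def
    by (intro Inf_lower CollectI exI[of _ ?T])
       (simp add: max_eq rho_eq lim_imp_Limsup[OF _ lim] lim_imp_Liminf[OF _ lim])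
qed

lemma sc_nonneg:
  assumes "finite X" "set_pmf \<rho> \<subseteq> X"
  shows "0 \<le> sc X r \<rho> S"
  unfolding sc_def
proof (rule Inf_greatest, clarify)
  fix T :: "nat \<Rightarrow> 'a list \<Rightarrow> real"
  assume T: "test_seq X T"
  have "0 \<le> neg_log (accept X n \<rho> (T n)) / ereal (real n)" if "n > 0" for n
  proof -
    have "accept X n \<rho> (T n) \<le> accept X n \<rho> (\<lambda>_. 1)" "0 \<le> accept X n \<rho> (T n)"
      using T by (auto simp: accept_def test_seq_def intro!: sum_mono sum_nonneg mult_left_le)
    then have "0 \<le> neg_log (accept X n \<rho> (T n))"
      using accept_const[OF assms, of n 1] by (auto simp: neg_log_def ln_le_zero_iff)
    then show ?thesis
      using that by (simp add: zero_le_divide_ereal)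
  qed
  then have "\<forall>\<^sub>F n in sequentially. 0 \<le> neg_log (accept X n \<rho> (T n)) / ereal (real n)"
    using eventually_gt_at_top[of 0] by (rule eventually_mono[rotated])
  then have "0 \<le> liminf (\<lambda>n. neg_log (accept X n \<rho> (T n)) / ereal (real n))"
    by (rule Liminf_bounded)
  also have "\<dots> \<le> limsup (\<lambda>n. neg_log (accept X n \<rho> (T n)) / ereal (real n))"
    by (rule Liminf_le_Limsup) simp
  finally show "0 \<le> limsup (\<lambda>n. neg_log (accept X n \<rho> (T n)) / ereal (real n))" .
qed

datatype coin = Heads | Tails

abbreviation coin_words :: "nat \<Rightarrow> coin list set"
  where "coin_words k \<equiv> seqs UNIV k"

end

theory Submission
  imports Defs
begin

text \<open>
  Write \<open>N = n k\<close> for the number of coins. By AM-GM, \<open>(\<sigma>\<^sub>1 + \<sigma>\<^sub>2) / 2\<close> is pointwise at least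
  \<open>\<surd>(\<sigma>\<^sub>1 \<sigma>\<^sub>2) = (\<surd>3 / 2)\<^sup>N \<rho>\<close>, so that no test against both alternatives beats the exponent
  \<open>r - k log (2 / \<surd>3)\<close>.

  Against a single alternative, accept only if the first \<open>\<eta> n\<close> words consist of the coin face that is
  rare under \<open>\<sigma>\<^sub>j\<close> and this face also makes up at least half of the other words. This event has
  \<open>\<rho>\<close>-probability at least \<open>2\<close> to the power \<open>- \<eta> N - 1\<close>, because swapping the faces preserves \<open>\<rho>\<close>, and
  on it \<open>\<sigma>\<^sub>j\<close> is smaller than \<open>(\<surd>3 / 2)\<^sup>N \<rho>\<close> by the further factor \<open>\<surd>3\<close> to the power \<open>- \<eta> N\<close>.
  Randomizing gives the exponent \<open>max (\<eta> k log 2) (r - k log (2 / \<surd>3) - \<eta> k log \<surd>3)\<close>. A small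
  \<open>\<eta>\<close> yields the first claim and \<open>\<eta> = 1\<close> the second.
\<close>

section \<open>Coin words and products over concatenated words\<close>

lemma finite_seqs: "finite X \<Longrightarrow> finite (seqs X n)"
  unfolding seqs_def by (rule finite_lists_length_eq)

lemma card_seqs: "finite X \<Longrightarrow> card (seqs X n) = card X ^ n"
  unfolding seqs_def by (rule card_lists_length_eq)

lemma UNIV_coin: "UNIV = {Heads, Tails}"
  using coin.exhaust by auto

instance coin :: finite
  by standard (simp add: UNIV_coin)

lemma card_coin_words: "card (coin_words k) = 2 ^ k"
proof -
  have "CARD(coin) = 2" by (simp add: UNIV_coin)
  then show ?thesis by (simp add: card_seqs)
qed

lemma pmf_Tails: "pmf p Tails = 1 - pmf p Heads"
proof -
  have "(\<Sum>x\<in>UNIV. pmf p x) = 1"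
    by (rule sum_pmf_eq_1) auto
  then show ?thesis by (simp add: UNIV_coin)
qed

lemma length_concat_seqs:
  "xs \<in> seqs (seqs X k) n \<Longrightarrow> length (concat xs) = n * k"
proof (induction xs arbitrary: n)
  case Nil
  then show ?case by (simp add: seqs_def)
next
  case (Cons x xs)
  then obtain n' where "n = Suc n'" "xs \<in> seqs (seqs X k) n'" "length x = k"
    by (auto simp: seqs_def)
  with Cons.IH show ?case by simp
qed

text \<open>Lets \<open>n\<close> samples of \<open>k\<close>-coin words be treated as one word of
  \<open>n * k\<close> independent coins: likelihoods depend only on
  \<open>concat xs\<close>.\<close>

lemma pmf_replicate_replicate:
  assumes "xs \<in> seqs (seqs X k) n"
  shows "pmf (replicate_pmf n (replicate_pmf k \<omega>)) xs = prod_list (map (pmf \<omega>) (concat xs))"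
proof -
  have "\<forall>x\<in>set xs. length x = k" "length xs = n"
    using assms by (auto simp: seqs_def)
  moreover have "\<forall>x\<in>set ys. length x = k \<Longrightarrow>
      prod_list (map (pmf (replicate_pmf k \<omega>)) ys) = prod_list (map (pmf \<omega>) (concat ys))" for ys
    by (induction ys) (auto simp: pmf_replicate_pmf)
  ultimately show ?thesis by (simp add: pmf_replicate_pmf)
qed

lemma prod_list_map_const:
  fixes b :: "'b :: comm_monoid_mult"
  assumes "\<And>x. f x = b"
  shows "prod_list (map f w) = b ^ length w"
  using assms by (induction w) auto

lemma prod_list_map_mult:
  fixes f g :: "'a \<Rightarrow> 'b :: comm_monoid_mult"
  shows "prod_list (map f w) * prod_list (map g w) = prod_list (map (\<lambda>x. f x * g x) w)"
  by (induction w) (auto simp: ac_simps)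

text \<open>Each occurrence of \<open>c\<close> replaces a factor 3/4 by a third of it, so the
  likelihood depends only on the length and the count of \<open>c\<close>.\<close>

lemma prod_list_biased:
  fixes f :: "'a \<Rightarrow> real"
  assumes "f c = 1 / 4" "\<And>x. x \<noteq> c \<Longrightarrow> f x = 3 / 4"
  shows "prod_list (map f w) * 3 ^ count_list w c = (3 / 4) ^ length w"
proof (induction w)
  case (Cons x w)
  show ?case
    by (cases "x = c") (simp_all add: assms flip: Cons.IH)
qed simp

section \<open>Symmetry under swapping the two faces\<close>

fun swap_coin :: "coin \<Rightarrow> coin" where
  "swap_coin Heads = Tails"
| "swap_coin Tails = Heads"

lemma swap_coin_swap_coin [simp]: "swap_coin (swap_coin x) = x"
  by (cases x) auto

lemma count_list_map_swap: "count_list (map swap_coin w) c + count_list w c = length w"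
proof (induction w)
  case (Cons x w)
  then show ?case by (cases x; cases c) auto
qed simp

lemma concat_map_map: "concat (map (map f) xs) = map f (concat xs)"
  by (simp add: map_concat)

lemma map_swap_seqs: "map (map swap_coin) xs \<in> seqs (coin_words k) n \<longleftrightarrow> xs \<in> seqs (coin_words k) n"
  by (auto simp: seqs_def)

text \<open>In a word or in its swap, \<open>c\<close> fills at least half of the places. Hence
  \<open>?B\<close> and its image under the swap cover all words, and the image is no larger than
  \<open>?B\<close>.\<close>

lemma card_majority:
  "2 ^ (n * k) \<le> 2 * card {xs \<in> seqs (coin_words k) n. n * k \<le> 2 * count_list (concat xs) c}"
    (is "_ \<le> 2 * card ?B")
proof -
  let ?U = "seqs (coin_words k) n"
  let ?f = "map (map swap_coin)"
  have fin: "finite ?U" by (intro finite_seqs) auto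
  have f_f: "?f (?f xs) = xs" for xs
    by (simp add: comp_def)
  have "?U \<subseteq> ?B \<union> ?f ` ?B"
  proof
    fix xs assume xs: "xs \<in> ?U"
    have "count_list (concat (?f xs)) c + count_list (concat xs) c = n * k"
      using count_list_map_swap[of "concat xs" c] length_concat_seqs[OF xs]
      by (simp add: concat_map_map)
    then have "xs \<in> ?B \<or> ?f xs \<in> ?B"
      using xs by (auto simp: map_swap_seqs)
    then show "xs \<in> ?B \<union> ?f ` ?B"
    proof
      assume "?f xs \<in> ?B"
      then have "?f (?f xs) \<in> ?f ` ?B" by (rule imageI)
      then show ?thesis unfolding f_f by (rule UnI2)
    qed (rule UnI1)
  qed
  moreover have finB: "finite ?B" using fin by auto
  ultimately have "card ?U \<le> card (?B \<union> ?f ` ?B)"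
    by (intro card_mono) auto
  also have "\<dots> \<le> card ?B + card (?f ` ?B)"
    by (rule card_Un_le)
  also have "\<dots> \<le> 2 * card ?B"
    using card_image_le[OF finB, of ?f] by simp
  finally show ?thesis
    by (simp add: card_seqs finite_seqs card_coin_words power_mult mult.commute)
qed

section \<open>Relative entropy of the product distributions\<close>

lemma sum_count_list: "(\<Sum>w\<in>coin_words k. real (count_list w c)) = 2 ^ k * (real k / 2)"
proof -
  \<comment> \<open>The swap permutes the words and turns a count of \<open>c\<close> into
    \<open>k\<close> minus that count, so the average count is \<open>k / 2\<close>.\<close>
  have "(\<Sum>w\<in>coin_words k. real (count_list w c)) = (\<Sum>w\<in>coin_words k. real (count_list (map swap_coin w) c))"
    by (rule sum.reindex_bij_witness[of _ "map swap_coin" "map swap_coin"])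
       (auto simp: seqs_def comp_def)
  moreover have "(\<Sum>w\<in>coin_words k. real (count_list w c)) + (\<Sum>w\<in>coin_words k. real (count_list (map swap_coin w) c))
      = (\<Sum>w\<in>coin_words k. real k)"
    unfolding sum.distrib[symmetric]
  proof (rule sum.cong)
    fix w assume "w \<in> coin_words k"
    then show "real (count_list w c) + real (count_list (map swap_coin w) c) = real k"
      using count_list_map_swap[of w c] by (simp add: seqs_def flip: of_nat_add)
  qed simp
  ultimately show ?thesis by (simp add: card_coin_words)
qed

text \<open>The log-likelihood ratio is affine in the count of \<open>c\<close>, so its mean follows
  from the mean count \<open>k / 2\<close>. The rare face \<open>c\<close> is a parameter in order
  to cover both alternatives.\<close>

lemma rel_entropy_fair_biased:
  assumes \<rho>: "\<And>x. pmf \<rho> x = 1 / 2"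
    and \<sigma>: "pmf \<sigma> c = 1 / 4" "\<And>x. x \<noteq> c \<Longrightarrow> pmf \<sigma> x = 3 / 4"
  shows "rel_entropy (coin_words k) (replicate_pmf k \<rho>) (replicate_pmf k \<sigma>) = ereal (real k * ln (2 / sqrt 3))"
proof -
  have eq: "pmf (replicate_pmf k \<rho>) w = 1 / 2 ^ k" "pmf (replicate_pmf k \<sigma>) w \<noteq> 0"
    "ln (pmf (replicate_pmf k \<rho>) w / pmf (replicate_pmf k \<sigma>) w) = real (count_list w c) * ln 3 + real k * ln (2 / 3)"
    if "w \<in> coin_words k" for w
  proof -
    have len: "length w = k" using that by (simp add: seqs_def)
    show 1: "pmf (replicate_pmf k \<rho>) w = 1 / 2 ^ k"
      using len by (simp add: pmf_replicate_pmf prod_list_map_const[of _ "1 / 2 :: real"] \<rho> power_one_over)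
    have 2: "pmf (replicate_pmf k \<sigma>) w = (3 / 4) ^ k / 3 ^ count_list w c"
      using prod_list_biased[of "pmf \<sigma>", OF \<sigma>, of w] len
      by (simp add: pmf_replicate_pmf field_simps)
    then show "pmf (replicate_pmf k \<sigma>) w \<noteq> 0" by simp
    have "pmf (replicate_pmf k \<rho>) w / pmf (replicate_pmf k \<sigma>) w = 3 ^ count_list w c * (2 / 3) ^ k"
      unfolding 1 2 by (simp add: field_simps flip: power_mult_distrib)
    then show "ln (pmf (replicate_pmf k \<rho>) w / pmf (replicate_pmf k \<sigma>) w) = real (count_list w c) * ln 3 + real k * ln (2 / 3)"
      by (simp add: ln_mult ln_realpow)
  qed
  have "rel_entropy (coin_words k) (replicate_pmf k \<rho>) (replicate_pmf k \<sigma>) =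
      (\<Sum>w\<in>coin_words k. ereal (1 / 2 ^ k * (real (count_list w c) * ln 3 + real k * ln (2 / 3))))"
    unfolding rel_entropy_def using eq by (intro sum.cong) (auto simp del: ereal_plus_eq_PInfty)
  also have "\<dots> = ereal (1 / 2 ^ k * ((\<Sum>w\<in>coin_words k. real (count_list w c)) * ln 3 + 2 ^ k * (real k * ln (2 / 3))))"
    by (simp add: sum.distrib card_coin_words flip: sum_distrib_left sum_distrib_right sum_divide_distrib)
  also have "\<dots> = ereal (real k * (ln 3 / 2 + ln (2 / 3)))"
    unfolding sum_count_list by (simp add: field_simps)
  also have "\<dots> = ereal (real k * ln (2 / sqrt 3))"
    by (simp add: ln_div ln_sqrt field_simps)
  finally show ?thesis .
qed

section \<open>Lower bound for the pair of alternatives\<close>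

lemma accept_nonneg:
  assumes "test_seq X T"
  shows "0 \<le> accept X n \<omega> (T n)"
  using assms by (auto simp: accept_def test_seq_def intro!: sum_nonneg)

text \<open>By \<open>prod\<close>, the geometric mean of the alternatives is
  \<open>sqrt 3 / 4\<close> per coin, which is \<open>sqrt 3 / 2\<close> times the fair probability,
  whatever the outcome.\<close>

lemma sc_pair_ge:
  assumes \<rho>: "\<And>x. pmf \<rho> x = 1 / 2"
    and prod: "\<And>x. pmf \<sigma>\<^sub>1 x * pmf \<sigma>\<^sub>2 x = 3 / 16"
  shows "ereal (r - real k * ln (2 / sqrt 3)) \<le>
    sc (coin_words k) r (replicate_pmf k \<rho>) {replicate_pmf k \<sigma>\<^sub>1, replicate_pmf k \<sigma>\<^sub>2}"
  unfolding sc_def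
proof (rule Inf_greatest, clarify)
  fix T :: "nat \<Rightarrow> coin list list \<Rightarrow> real"
  let ?X = "coin_words k"
  let ?M = "\<lambda>n. MAX \<sigma>\<in>{replicate_pmf k \<sigma>\<^sub>1, replicate_pmf k \<sigma>\<^sub>2}. accept ?X n \<sigma> (T n)"
  let ?P = "\<lambda>n. accept ?X n (replicate_pmf k \<rho>) (T n)"
  let ?c = "real k * ln (2 / sqrt 3)"
  assume T: "test_seq ?X T"
    and r: "ereal r \<le> liminf (\<lambda>n. neg_log (?M n) / ereal (real n))"
  \<comment> \<open>AM-GM holds word by word. Weighting by the test and summing bounds the left side
    by the average of the two acceptance probabilities, hence by their maximum.\<close>
  have P_le: "?P n \<le> (2 / sqrt 3) ^ (n * k) * ?M n" for n
  proof -
    let ?A1 = "accept ?X n (replicate_pmf k \<sigma>\<^sub>1) (T n)" and ?A2 = "accept ?X n (replicate_pmf k \<sigma>\<^sub>2) (T n)"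
    have "?P n * (sqrt 3 / 2) ^ (n * k) \<le> (?A1 + ?A2) / 2"
      unfolding accept_def sum_distrib_right sum.distrib[symmetric] sum_divide_distrib
    proof (rule sum_mono)
      fix xs assume xs: "xs \<in> seqs ?X n"
      let ?p1 = "prod_list (map (pmf \<sigma>\<^sub>1) (concat xs))" and ?p2 = "prod_list (map (pmf \<sigma>\<^sub>2) (concat xs))"
      have len: "length (concat xs) = n * k" by (rule length_concat_seqs[OF xs])
      have "?p1 * ?p2 = (3 / 16) ^ (n * k)"
        unfolding prod_list_map_mult using prod len by (simp add: prod_list_map_const[of _ "3 / 16 :: real"])
      moreover have "sqrt (3 / 16) = sqrt 3 / 4"
        by (rule real_sqrt_unique) (auto simp: power_divide)
      moreover have "0 \<le> ?p1" "0 \<le> ?p2" by (auto intro!: prod_list_nonneg)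
      ultimately have "(sqrt 3 / 4) ^ (n * k) \<le> (?p1 + ?p2) / 2"
        using arith_geo_mean_sqrt[of ?p1 ?p2] by (simp only: real_sqrt_power)
      then have "(1 / 2) ^ (n * k) * (sqrt 3 / 2) ^ (n * k) * T n xs \<le> (?p1 + ?p2) / 2 * T n xs"
        using T xs by (intro mult_right_mono) (auto simp: test_seq_def simp flip: power_mult_distrib)
      then show "pmf (replicate_pmf n (replicate_pmf k \<rho>)) xs * T n xs * (sqrt 3 / 2) ^ (n * k)
          \<le> (pmf (replicate_pmf n (replicate_pmf k \<sigma>\<^sub>1)) xs * T n xs +
             pmf (replicate_pmf n (replicate_pmf k \<sigma>\<^sub>2)) xs * T n xs) / 2"
        using len by (simp add: pmf_replicate_replicate[OF xs] prod_list_map_const[of _ "1 / 2 :: real"] \<rho> algebra_simps add_divide_distrib)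
    qed
    also have "\<dots> \<le> ?M n" by (simp add: max_def)
    finally have "?P n * (sqrt 3 / 2) ^ (n * k) \<le> ?M n" .
    then have "(2 / sqrt 3) ^ (n * k) * (?P n * (sqrt 3 / 2) ^ (n * k)) \<le> (2 / sqrt 3) ^ (n * k) * ?M n"
      by (intro mult_left_mono) auto
    moreover have "(2 / sqrt 3) ^ (n * k) * (sqrt 3 / 2) ^ (n * k) = (1 :: real)"
      by (simp flip: power_mult_distrib)
    ultimately show ?thesis by (simp only: mult.left_commute[of "(2 / sqrt 3) ^ (n * k)"] mult_1_right)
  qed
  have "neg_log (?M n) / ereal (real n) \<le> neg_log (?P n) / ereal (real n) + ereal ?c" if "n > 0" for n
  proof (cases "?P n = 0")
    case True
    then show ?thesis using that by (simp add: neg_log_def)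
  next
    case False
    then have P: "0 < ?P n" using accept_nonneg[OF T] by (simp add: order_less_le)
    have pos: "0 < (2 / sqrt 3) ^ (n * k)" by simp
    \<comment> \<open>\<open>P_le\<close> excludes \<open>?M n = 0\<close>, so both values of
      \<open>neg_log\<close> are finite here. In the other case the right side is infinite.\<close>
    have M: "0 < ?M n"
      by (rule zero_less_mult_pos[OF less_le_trans[OF P P_le] pos])
    have "ln (?P n) \<le> ln ((2 / sqrt 3) ^ (n * k) * ?M n)"
      using P P_le[of n] by simp
    also have "\<dots> = real n * ?c + ln (?M n)"
      using M pos by (subst ln_mult_pos) (simp_all add: ln_realpow)
    finally have "- ln (?M n) / real n \<le> - ln (?P n) / real n + ?c"
      using that by (simp add: field_simps)
    then show ?thesis
      using P M that by (simp add: neg_log_def)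
  qed
  then have "\<forall>\<^sub>F n in sequentially. neg_log (?M n) / ereal (real n) \<le> neg_log (?P n) / ereal (real n) + ereal ?c"
    using eventually_gt_at_top[of 0] by (rule eventually_mono[rotated])
  \<comment> \<open>The constraint is a liminf and the objective a limsup, so the passage from one
    to the other goes in the required direction.\<close>
  then have "liminf (\<lambda>n. neg_log (?M n) / ereal (real n)) \<le> liminf (\<lambda>n. neg_log (?P n) / ereal (real n) + ereal ?c)"
    by (rule Liminf_mono)
  also have "\<dots> \<le> limsup (\<lambda>n. neg_log (?P n) / ereal (real n) + ereal ?c)"
    by (rule Liminf_le_Limsup) simp
  also have "\<dots> = limsup (\<lambda>n. neg_log (?P n) / ereal (real n)) + ereal ?c"
    by (rule Limsup_add_ereal_right) auto
  finally have "ereal r \<le> limsup (\<lambda>n. neg_log (?P n) / ereal (real n)) + ereal ?c"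
    using r by (rule order_trans[rotated])
  then show "ereal (r - ?c) \<le> limsup (\<lambda>n. neg_log (?P n) / ereal (real n))"
    by (cases "limsup (\<lambda>n. neg_log (?P n) / ereal (real n))") auto
qed

section \<open>Upper bound for a single alternative\<close>

lemma accept_scaled_indicator:
  assumes "finite X" "A \<subseteq> seqs X n"
  shows "accept X n \<omega> (\<lambda>xs. if xs \<in> A then l else 0) = l * (\<Sum>xs\<in>A. pmf (replicate_pmf n \<omega>) xs)"
proof -
  have "accept X n \<omega> (\<lambda>xs. if xs \<in> A then l else 0) = (\<Sum>xs\<in>seqs X n. if xs \<in> A then pmf (replicate_pmf n \<omega>) xs * l else 0)"
    unfolding accept_def by (intro sum.cong) auto
  also have "\<dots> = (\<Sum>xs\<in>A. pmf (replicate_pmf n \<omega>) xs * l)"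
    using assms by (simp add: sum.If_cases finite_seqs Int_absorb1)
  finally show ?thesis by (simp add: sum_distrib_left mult.commute)
qed

text \<open>With \<open>m\<close> leading words of pure \<open>c\<close> and a majority of
  \<open>c\<close> afterwards, \<open>c\<close> occurs at least \<open>(n + m) * k / 2\<close>
  times. Each occurrence triples the likelihood ratio, which starts from
  \<open>(2 / 3) ^ (n * k)\<close>. The mass under \<open>\<sigma>\<close> must be positive because
  a test is later normalized by it.\<close>

lemma exists_biased_event:
  assumes \<rho>: "\<And>x. pmf \<rho> x = 1 / 2"
    and \<sigma>: "pmf \<sigma> c = 1 / 4" "\<And>x. x \<noteq> c \<Longrightarrow> pmf \<sigma> x = 3 / 4"
    and m: "m \<le> n"
  obtains A where "A \<subseteq> seqs (coin_words k) n"
    "1 / 2 ^ (m * k + 1) \<le> (\<Sum>xs\<in>A. pmf (replicate_pmf n (replicate_pmf k \<rho>)) xs)"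
    "0 < (\<Sum>xs\<in>A. pmf (replicate_pmf n (replicate_pmf k \<sigma>)) xs)"
    "(2 / sqrt 3) ^ (n * k) * sqrt 3 ^ (m * k) * (\<Sum>xs\<in>A. pmf (replicate_pmf n (replicate_pmf k \<sigma>)) xs)
      \<le> (\<Sum>xs\<in>A. pmf (replicate_pmf n (replicate_pmf k \<rho>)) xs)"
proof -
  let ?B = "{ys \<in> seqs (coin_words k) (n - m). (n - m) * k \<le> 2 * count_list (concat ys) c}"
  let ?A = "(\<lambda>ys. replicate m (replicate k c) @ ys) ` ?B"
  let ?R = "pmf (replicate_pmf n (replicate_pmf k \<rho>))" and ?S = "pmf (replicate_pmf n (replicate_pmf k \<sigma>))"
  have sub: "?A \<subseteq> seqs (coin_words k) n"
    using m by (auto simp: seqs_def)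
  have finB: "finite ?B" by (simp add: finite_seqs)
  have nk: "n * k = m * k + (n - m) * k"
    using m by (metis add_mult_distrib le_add_diff_inverse)
  have R: "?R xs = 1 / 2 ^ (n * k)" if "xs \<in> ?A" for xs
  proof -
    have xs: "xs \<in> seqs (coin_words k) n" using sub that by blast
    show ?thesis
      using length_concat_seqs[OF xs]
      by (simp add: pmf_replicate_replicate[OF xs] prod_list_map_const[of _ "1 / 2 :: real"] \<rho> power_one_over)
  qed
  have S: "0 < ?S xs \<and> (2 / sqrt 3) ^ (n * k) * sqrt 3 ^ (m * k) * ?S xs \<le> ?R xs" if xs: "xs \<in> ?A" for xs
  proof -
    have xs': "xs \<in> seqs (coin_words k) n" using sub xs by blast
    let ?h = "count_list (concat xs) c"
    have "count_list (replicate k c) c = k" by (induction k) auto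
    then have "count_list (concat (replicate m (replicate k c))) c = m * k"
      by (induction m) (auto simp: count_list_append)
    \<comment> \<open>The prefix contributes \<open>m * k\<close> occurrences and the rest at least
      half of its coins. Doubling avoids halves in the naturals.\<close>
    then have "(n - m) * k + 2 * (m * k) \<le> 2 * ?h"
      using xs by (auto simp: count_list_append)
    then have h: "n * k + m * k \<le> 2 * ?h"
      using nk by linarith
    have S_eq: "?S xs = (3 / 4) ^ (n * k) / 3 ^ ?h"
      using prod_list_biased[of "pmf \<sigma>", OF \<sigma>, of "concat xs"] length_concat_seqs[OF xs']
      by (simp add: pmf_replicate_replicate[OF xs'] field_simps)
    have "sqrt 3 ^ (n * k + m * k) \<le> sqrt 3 ^ (2 * ?h)"
      using h by (intro power_increasing) auto
    also have "\<dots> = 3 ^ ?h" by (simp add: power_mult)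
    finally have le: "sqrt 3 ^ (n * k + m * k) \<le> 3 ^ ?h" .
    have "(2 / sqrt 3) ^ (n * k) * (3 / 4) ^ (n * k) = (1 / 2 * sqrt 3) ^ (n * k)"
    proof -
      have "2 / sqrt 3 * (3 / 4) = 1 / 2 * sqrt 3"
        by (simp add: field_simps)
      then show ?thesis by (metis power_mult_distrib)
    qed
    also have "\<dots> = (1 / 2) ^ (n * k) * sqrt 3 ^ (n * k)"
      by (rule power_mult_distrib)
    finally have "(2 / sqrt 3) ^ (n * k) * sqrt 3 ^ (m * k) * ?S xs
        = (1 / 2) ^ (n * k) * (sqrt 3 ^ (n * k + m * k) / 3 ^ ?h)"
      unfolding S_eq by (simp add: power_add mult.assoc mult.left_commute mult.commute)
    also have "\<dots> \<le> (1 / 2) ^ (n * k) * 1"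
      using le by (intro mult_left_mono) auto
    also have "\<dots> = ?R xs" using R[OF xs] by (simp add: power_one_over)
    finally show ?thesis by (simp add: S_eq)
  qed
  \<comment> \<open>Prepending the fixed prefix is injective and the fair distribution is uniform,
    so the mass of \<open>?A\<close> is a matter of counting \<open>?B\<close>.\<close>
  have "card ?A = card ?B" by (intro card_image inj_onI) auto
  moreover have card: "2 ^ ((n - m) * k) \<le> 2 * card ?B" by (rule card_majority)
  ultimately have sum_R: "(\<Sum>xs\<in>?A. ?R xs) = real (card ?B) / 2 ^ (n * k)"
    using R by simp
  have "(2 :: real) ^ (n * k) = 2 ^ (m * k) * 2 ^ ((n - m) * k)"
    by (subst nk) (rule power_add)
  then have "(1 :: real) / 2 ^ (m * k + 1) = 2 ^ ((n - m) * k) / (2 * 2 ^ (n * k))"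
    by simp
  also have "\<dots> \<le> 2 * real (card ?B) / (2 * 2 ^ (n * k))"
    using of_nat_mono[OF card, where 'a = real] by (intro divide_right_mono) auto
  also have "\<dots> = (\<Sum>xs\<in>?A. ?R xs)"
    unfolding sum_R by (rule mult_divide_mult_cancel_left) simp
  finally have 1: "1 / 2 ^ (m * k + 1) \<le> (\<Sum>xs\<in>?A. ?R xs)" .
  have "?B \<noteq> {}" using card by (auto simp del: Collect_empty_eq)
  then have 2: "0 < (\<Sum>xs\<in>?A. ?S xs)"
    using S finB by (intro sum_pos) auto
  have 3: "(2 / sqrt 3) ^ (n * k) * sqrt 3 ^ (m * k) * (\<Sum>xs\<in>?A. ?S xs) \<le> (\<Sum>xs\<in>?A. ?R xs)"
    unfolding sum_distrib_left using S by (intro sum_mono) auto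
  show ?thesis by (rule that[OF sub 1 2 3])
qed

text \<open>The two terms of the maximum are the costs of the test without and with randomization;
  \<open>\<eta>\<close> is the fraction of words forced to be pure \<open>c\<close>.\<close>

lemma sc_single_le:
  assumes \<rho>: "\<And>x. pmf \<rho> x = 1 / 2"
    and \<sigma>: "pmf \<sigma> c = 1 / 4" "\<And>x. x \<noteq> c \<Longrightarrow> pmf \<sigma> x = 3 / 4"
    and \<eta>: "0 \<le> \<eta>" "\<eta> \<le> 1"
  shows "sc (coin_words k) r (replicate_pmf k \<rho>) {replicate_pmf k \<sigma>} \<le>
    ereal (max (\<eta> * (real k * ln 2)) (r - real k * ln (2 / sqrt 3) - \<eta> * (real k * ln (sqrt 3))))"
    (is "_ \<le> ereal (max ?a ?b)")
proof -
  let ?X = "coin_words k"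
  define u where "u = max ?a ?b"
  have u: "?a \<le> u" "?b \<le> u" by (simp_all only: u_def max.cobounded1 max.cobounded2)
  define m where "m n = nat \<lfloor>\<eta> * real n\<rfloor>" for n
  have m_le: "real (m n) \<le> \<eta> * real n" and m_ge: "\<eta> * real n - 1 \<le> real (m n)" for n
    using \<eta> by (auto simp: m_def of_nat_nat)
  have "real (m n) \<le> real n" for n
    using m_le[of n] mult_right_mono[OF \<eta>(2), of "real n"] by simp
  then have m_n: "m n \<le> n" for n by simp
  let ?R = "\<lambda>n A. \<Sum>xs\<in>A. pmf (replicate_pmf n (replicate_pmf k \<rho>)) xs"
  let ?S = "\<lambda>n A. \<Sum>xs\<in>A. pmf (replicate_pmf n (replicate_pmf k \<sigma>)) xs"
  have "\<exists>A. A \<subseteq> seqs ?X n \<and> 1 / 2 ^ (m n * k + 1) \<le> ?R n A \<and> 0 < ?S n A \<and>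
      (2 / sqrt 3) ^ (n * k) * sqrt 3 ^ (m n * k) * ?S n A \<le> ?R n A" for n
    by (rule exists_biased_event[OF \<rho> \<sigma> m_n[of n], of k]) blast+
  then obtain A where A: "\<And>n. A n \<subseteq> seqs ?X n"
    and R_ge: "\<And>n. 1 / 2 ^ (m n * k + 1) \<le> ?R n (A n)"
    and S_pos: "\<And>n. 0 < ?S n (A n)"
    and S_le: "\<And>n. (2 / sqrt 3) ^ (n * k) * sqrt 3 ^ (m n * k) * ?S n (A n) \<le> ?R n (A n)"
    by metis
  \<comment> \<open>The largest factor up to 1 that brings the acceptance probability under
    \<open>\<sigma>\<close> down to \<open>exp (- (real n * r))\<close>.\<close>
  define l where "l n = min 1 (exp (- (real n * r)) / ?S n (A n))" for n
  have l: "0 < l n" "l n \<le> 1" for n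
    using S_pos[of n] by (auto simp: l_def)
  define T where "T n = (\<lambda>xs. if xs \<in> A n then l n else 0)" for n
  have T: "test_seq ?X T"
    using l by (auto simp: test_seq_def T_def less_imp_le)
  have finX: "finite ?X" by (simp add: finite_seqs)
  have acc: "accept ?X n (replicate_pmf k \<omega>) (T n) = l n * (\<Sum>xs\<in>A n. pmf (replicate_pmf n (replicate_pmf k \<omega>)) xs)"
    for n \<omega> unfolding T_def by (rule accept_scaled_indicator[OF finX A])
  have "ereal r \<le> neg_log (accept ?X n (replicate_pmf k \<sigma>) (T n)) / ereal (real n)" if n: "n > 0" for n
  proof -
    have "l n * ?S n (A n) \<le> exp (- (real n * r)) / ?S n (A n) * ?S n (A n)"
      using S_pos[of n] by (intro mult_right_mono) (auto simp: l_def)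
    then have "l n * ?S n (A n) \<le> exp (- (real n * r))"
      using S_pos[of n] by simp
    then have "ln (l n * ?S n (A n)) \<le> ln (exp (- (real n * r)))"
      using l[of n] S_pos[of n] by (subst ln_le_cancel_iff) auto
    then have "r \<le> - ln (l n * ?S n (A n)) / real n"
      using n by (simp add: field_simps)
    moreover have "l n * ?S n (A n) \<noteq> 0"
      using l[of n] S_pos[of n] by simp
    ultimately show ?thesis using n by (simp add: acc neg_log_def)
  qed
  then have "\<forall>\<^sub>F n in sequentially. ereal r \<le> neg_log (accept ?X n (replicate_pmf k \<sigma>) (T n)) / ereal (real n)"
    using eventually_gt_at_top[of 0] by (rule eventually_mono[rotated])
  then have r: "ereal r \<le> liminf (\<lambda>n. neg_log (accept ?X n (replicate_pmf k \<sigma>) (T n)) / ereal (real n))"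
    by (rule Liminf_bounded)
  \<comment> \<open>Collects the losses at finite \<open>n\<close>: \<open>ln 2\<close> for
    restricting to the majority event, the other term for rounding \<open>\<eta> * real n\<close>
    down. Divided by \<open>n\<close> they vanish.\<close>
  let ?C = "ln 2 + real k * ln (sqrt 3)"
  have "neg_log (accept ?X n (replicate_pmf k \<rho>) (T n)) / ereal (real n) \<le> ereal (u + ?C / real n)"
    if n: "n > 0" for n
  proof -
    have ln_pos: "0 \<le> ln (2 :: real)" "0 \<le> ln (sqrt 3)" by auto
    have R_pos: "0 < ?R n (A n)" by (rule less_le_trans[OF _ R_ge]) simp
    have C1: "- ln (?R n (A n)) \<le> real n * ?a + ?C"
    proof -
      have "ln (1 / 2 ^ (m n * k + 1)) \<le> ln (?R n (A n))"
        using R_ge[of n] R_pos by (subst ln_le_cancel_iff) auto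
      then have "- ln (?R n (A n)) \<le> real (m n) * (real k * ln 2) + ln 2"
        by (simp add: ln_div ln_mult_pos ln_realpow algebra_simps)
      also have "\<dots> \<le> \<eta> * real n * (real k * ln 2) + ?C"
        using m_le[of n] ln_pos by (intro add_mono mult_right_mono) auto
      finally show ?thesis by (simp add: algebra_simps)
    qed
    \<comment> \<open>When the minimum in \<open>l n\<close> is below 1, the acceptance probability
      under \<open>\<rho>\<close> is \<open>exp (- (real n * r))\<close> times the ratio of the two
      masses of the event.\<close>
    have C2: "- ln (exp (- (real n * r)) * (?R n (A n) / ?S n (A n))) \<le> real n * ?b + ?C"
    proof -
      have "(2 / sqrt 3) ^ (n * k) * sqrt 3 ^ (m n * k) \<le> ?R n (A n) / ?S n (A n)"
        using S_le[of n] S_pos[of n] by (simp add: le_divide_eq)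
      then have "ln ((2 / sqrt 3) ^ (n * k) * sqrt 3 ^ (m n * k)) \<le> ln (?R n (A n) / ?S n (A n))"
        using R_pos S_pos[of n] by (subst ln_le_cancel_iff) auto
      then have "real n * (real k * ln (2 / sqrt 3)) + real (m n) * (real k * ln (sqrt 3)) \<le> ln (?R n (A n) / ?S n (A n))"
        by (simp add: ln_mult_pos ln_realpow)
      moreover have "(\<eta> * real n - 1) * (real k * ln (sqrt 3)) \<le> real (m n) * (real k * ln (sqrt 3))"
        using m_ge[of n] ln_pos by (intro mult_right_mono) auto
      then have "\<eta> * real n * (real k * ln (sqrt 3)) - real k * ln (sqrt 3) \<le> real (m n) * (real k * ln (sqrt 3))"
        by (simp only: left_diff_distrib mult_1)
      moreover have "real n * ?b = real n * r - real n * (real k * ln (2 / sqrt 3)) - \<eta> * real n * (real k * ln (sqrt 3))"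
        by (simp only: right_diff_distrib mult.assoc mult.left_commute)
      moreover have "ln (exp (- (real n * r)) * (?R n (A n) / ?S n (A n))) = - (real n * r) + ln (?R n (A n) / ?S n (A n))"
        using R_pos S_pos[of n] by (subst ln_mult_pos) auto
      ultimately show ?thesis using ln_pos by linarith
    qed
    have "real n * ?a \<le> real n * u" "real n * ?b \<le> real n * u"
      by (intro mult_left_mono u of_nat_0_le_iff)+
    note C = order_trans[OF C1 add_right_mono[OF this(1)]] order_trans[OF C2 add_right_mono[OF this(2)]]
    have "- ln (l n * ?R n (A n)) \<le> real n * u + ?C"
    \<comment> \<open>Which argument attains the minimum in \<open>l n\<close> decides which term of
      the maximum is the bound.\<close>
    proof (cases "1 \<le> exp (- (real n * r)) / ?S n (A n)")
      case True
      then have "l n * ?R n (A n) = ?R n (A n)" by (simp only: l_def min_absorb1 mult_1)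
      then show ?thesis using C(1) by (simp only:)
    next
      case False
      then have "l n * ?R n (A n) = exp (- (real n * r)) * (?R n (A n) / ?S n (A n))"
        by (simp only: l_def min_absorb2 not_le less_imp_le times_divide_eq_left times_divide_eq_right)
      then show ?thesis using C(2) by (simp only:)
    qed
    then have "- ln (l n * ?R n (A n)) / real n \<le> (real n * u + ?C) / real n"
      by (intro divide_right_mono) auto
    also have "\<dots> = u + ?C / real n"
      using n by (simp add: add_divide_distrib)
    finally have "- ln (l n * ?R n (A n)) / real n \<le> u + ?C / real n" .
    moreover have "l n * ?R n (A n) \<noteq> 0" using l[of n] R_pos by simp
    ultimately show ?thesis using n by (simp add: acc neg_log_def)
  qed
  then have "\<forall>\<^sub>F n in sequentially. neg_log (accept ?X n (replicate_pmf k \<rho>) (T n)) / ereal (real n) \<le> ereal (u + ?C / real n)"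
    using eventually_gt_at_top[of 0] by (rule eventually_mono[rotated])
  then have "limsup (\<lambda>n. neg_log (accept ?X n (replicate_pmf k \<rho>) (T n)) / ereal (real n)) \<le> limsup (\<lambda>n. ereal (u + ?C / real n))"
    by (rule Limsup_mono)
  also have "\<dots> = ereal (u)"
  proof (rule lim_imp_Limsup)
    have "(\<lambda>n. u + ?C / real n) \<longlonglongrightarrow> u + 0"
      by (intro tendsto_add tendsto_const lim_const_over_n)
    then show "(\<lambda>n. ereal (u + ?C / real n)) \<longlonglongrightarrow> ereal (u)"
      by simp
  qed simp
  finally have le: "limsup (\<lambda>n. neg_log (accept ?X n (replicate_pmf k \<rho>) (T n)) / ereal (real n)) \<le> ereal (u)" .
  have "sc ?X r (replicate_pmf k \<rho>) {replicate_pmf k \<sigma>} \<le>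
      limsup (\<lambda>n. neg_log (accept ?X n (replicate_pmf k \<rho>) (T n)) / ereal (real n))"
    unfolding sc_def using T r by (intro Inf_lower CollectI exI[of _ T]) simp
  then show ?thesis using le unfolding u_def by (rule order_trans)
qed

section \<open>Comparison of the exponents\<close>

theorem propositionV21:
  fixes \<rho> \<sigma>\<^sub>1 \<sigma>\<^sub>2 :: "coin pmf" and k :: nat and r :: real
  assumes "pmf \<rho> Heads = 1 / 2" and "pmf \<sigma>\<^sub>1 Heads = 1 / 4" and "pmf \<sigma>\<^sub>2 Heads = 3 / 4"
    and "k \<ge> 1"
  shows "let X = coin_words k; R = replicate_pmf k \<rho>;
             S\<^sub>1 = replicate_pmf k \<sigma>\<^sub>1; S\<^sub>2 = replicate_pmf k \<sigma>\<^sub>2;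
             gap = sc X r R {S\<^sub>1, S\<^sub>2} - max (sc X r R {S\<^sub>1}) (sc X r R {S\<^sub>2})
         in rel_entropy X R S\<^sub>1 = ereal (real k * ln (2 / sqrt 3)) \<and>
            rel_entropy X R S\<^sub>2 = ereal (real k * ln (2 / sqrt 3)) \<and>
            (r > real k * ln (2 / sqrt 3) \<longrightarrow> gap > 0) \<and>
            (r \<ge> real k * ln 4 \<longrightarrow> gap \<ge> ereal (real k * ln (sqrt 3)))"
proof -
  let ?X = "coin_words k" and ?R = "replicate_pmf k \<rho>"
  let ?S1 = "replicate_pmf k \<sigma>\<^sub>1" and ?S2 = "replicate_pmf k \<sigma>\<^sub>2"
  let ?L = "real k * ln (2 / sqrt 3)"
  let ?gap = "sc ?X r ?R {?S1, ?S2} - max (sc ?X r ?R {?S1}) (sc ?X r ?R {?S2})"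
  have \<rho>: "pmf \<rho> x = 1 / 2" for x
    using assms(1) by (cases x) (auto simp: pmf_Tails)
  have \<sigma>1: "pmf \<sigma>\<^sub>1 Heads = 1 / 4" "x \<noteq> Heads \<Longrightarrow> pmf \<sigma>\<^sub>1 x = 3 / 4" for x
    using assms(2) by (cases x, auto simp: pmf_Tails)+
  \<comment> \<open>Stated with \<open>Tails\<close> as the rare face, so that the bound for one
    alternative applies to \<open>\<sigma>\<^sub>2\<close> as well.\<close>
  have \<sigma>2: "pmf \<sigma>\<^sub>2 Tails = 1 / 4" "x \<noteq> Tails \<Longrightarrow> pmf \<sigma>\<^sub>2 x = 3 / 4" for x
    using assms(3) by (cases x, auto simp: pmf_Tails)+
  have prod: "pmf \<sigma>\<^sub>1 x * pmf \<sigma>\<^sub>2 x = 3 / 16" for x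
    by (cases x) (simp_all add: \<sigma>1 \<sigma>2)
  have L: "0 < ln (2 / sqrt 3)"
  proof (rule ln_gt_zero)
    have "sqrt 3 < sqrt (2\<^sup>2)" by (subst real_sqrt_less_iff) simp
    then show "1 < 2 / sqrt 3" by simp
  qed
  \<comment> \<open>Any \<open>u\<close> above both terms bounds both single exponents, while the
    pair costs at least \<open>r - ?L\<close>.\<close>
  have gap_ge: "ereal (r - ?L - u) \<le> ?gap"
    if "0 \<le> \<eta>" "\<eta> \<le> 1" and u: "\<eta> * (real k * ln 2) \<le> u" "r - ?L - \<eta> * (real k * ln (sqrt 3)) \<le> u" for \<eta> u
  proof -
    have "ereal (max (\<eta> * (real k * ln 2)) (r - ?L - \<eta> * (real k * ln (sqrt 3)))) \<le> ereal u"
      unfolding ereal_less_eq using u by (rule max.boundedI)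
    then have "max (sc ?X r ?R {?S1}) (sc ?X r ?R {?S2}) \<le> ereal u"
      using sc_single_le[OF \<rho> \<sigma>1 that(1,2), of k r] sc_single_le[OF \<rho> \<sigma>2 that(1,2), of k r]
      by (intro max.boundedI) (erule order_trans[rotated], assumption)+
    from ereal_minus_mono[OF sc_pair_ge[OF \<rho> prod, of r k] this]
    show ?thesis unfolding ereal_minus(1) .
  qed
  have "0 < ?gap" if r: "r > ?L"
  proof -
    \<comment> \<open>The 2 in the denominator keeps the first term at most
      \<open>(r - ?L) / 2\<close>. Positivity of \<open>\<eta>\<close> puts the second term strictly
      below \<open>r - ?L\<close>, too.\<close>
    define \<eta> where "\<eta> = min 1 ((r - ?L) / (2 * real k * ln 2))"
    define u where "u = max (\<eta> * (real k * ln 2)) (r - ?L - \<eta> * (real k * ln (sqrt 3)))"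
    have k: "0 < real k" using assms(4) by simp
    have \<eta>: "0 < \<eta>" "\<eta> \<le> 1" using r k by (auto simp: \<eta>_def)
    have "\<eta> * (real k * ln 2) \<le> (r - ?L) / (2 * real k * ln 2) * (real k * ln 2)"
      using k by (intro mult_right_mono) (auto simp: \<eta>_def)
    also have "\<dots> < r - ?L" using r k by (simp add: field_simps)
    finally have "\<eta> * (real k * ln 2) < r - ?L" .
    moreover have "0 < \<eta> * (real k * ln (sqrt 3))" using \<eta> k by simp
    ultimately have "0 < r - ?L - u"
      unfolding u_def by linarith
    then have "0 < ereal (r - ?L - u)"
      unfolding zero_ereal_def less_ereal.simps(1) .
    also have "\<dots> \<le> ?gap"
      using \<eta> by (intro gap_ge[of \<eta>]) (simp_all add: u_def)
    finally show ?thesis .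
  qed
  moreover have "ereal (real k * ln (sqrt 3)) \<le> ?gap" if r: "r \<ge> real k * ln 4"
  proof -
    have "real k * ln 4 = 2 * (real k * ln (2 :: real))" using ln_realpow[of 2 2] by simp
    moreover have "?L = real k * ln 2 - real k * ln (sqrt 3)"
      by (simp add: ln_div right_diff_distrib)
    \<comment> \<open>Here \<open>\<eta> = 1\<close> and \<open>u\<close> is the second term, so the
      gap is at least \<open>real k * ln (sqrt 3)\<close>. As
      \<open>?L + real k * ln (sqrt 3) = real k * ln 2\<close>, the second term dominates exactly
      from \<open>r = real k * ln 4\<close> on.\<close>
    ultimately have "1 * (real k * ln 2) \<le> r - ?L - real k * ln (sqrt 3)"
      using r by linarith
    from gap_ge[OF _ _ this] show ?thesis by simp
  qed
  ultimately show ?thesis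
    using rel_entropy_fair_biased[OF \<rho> \<sigma>1, of k] rel_entropy_fair_biased[OF \<rho> \<sigma>2, of k]
    by (simp add: Let_def)
qed

end
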